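(* Let $\mathbb{k}$ be a field, $n\ge1$, and let $q$ be a weak quadratic form on the cyclic group $\mathbb{Z}_n$ (written additively) with values in $\mathbb{k}^\times$. Then for every integer $k\geq2$ $$q(k)=q(1)^k\,\beta_q(1,1)^{\binom{k}{2}},$$ where integers are regarded as elements of $\mathbb{Z}_n$ via reduction modulo $n$.
   Context: For a map $q:\mathbb{Z}_n\to\mathbb{k}^\times$ put $\beta_q(a,b)=q(a+b)q(a)^{-1}q(b)^{-1}$; $q$ is a weak quadratic form if $\beta_q:\mathbb{Z}_n\times\mathbb{Z}_n\to\mathbb{k}^\times$ is a bihomomorphism. *)

theory Defs
  imports "HOL-Algebra.Algebra"
begin

text \<open>
  Below, the group operation of the source \<open>A\<close> corresponds to addition in \<open>\<int>\<^sub>n\<close>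
  (\<^const>\<open>integer_mod_group\<close>), although HOL-Algebra writes every group multiplicatively;
  the target \<open>H\<close> plays the role of the group of nonzero scalars.
\<close>

definition assoc_beta ::
    "('a, 'c) monoid_scheme \<Rightarrow> ('b, 'd) monoid_scheme \<Rightarrow> ('a \<Rightarrow> 'b) \<Rightarrow> 'a \<Rightarrow> 'a \<Rightarrow> 'b" where
  "assoc_beta A H q a b =
     q (a \<otimes>\<^bsub>A\<^esub> b) \<otimes>\<^bsub>H\<^esub> inv\<^bsub>H\<^esub> (q a) \<otimes>\<^bsub>H\<^esub> inv\<^bsub>H\<^esub> (q b)"

definition bihomomorphism ::
    "('a, 'c) monoid_scheme \<Rightarrow> ('b, 'd) monoid_scheme \<Rightarrow> ('a \<Rightarrow> 'a \<Rightarrow> 'b) \<Rightarrow> bool" where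
  "bihomomorphism A H f \<longleftrightarrow>
     (\<forall>b \<in> carrier A. (\<lambda>a. f a b) \<in> hom A H) \<and>
     (\<forall>a \<in> carrier A. (\<lambda>b. f a b) \<in> hom A H)"

text \<open>``Weak'': the symmetry condition \<open>q (- a) = q a\<close> of a quadratic form is not required.\<close>

definition weak_quadratic_form ::
    "('a, 'c) monoid_scheme \<Rightarrow> ('b, 'd) monoid_scheme \<Rightarrow> ('a \<Rightarrow> 'b) \<Rightarrow> bool" where
  "weak_quadratic_form A H q \<longleftrightarrow>
     q \<in> carrier A \<rightarrow> carrier H \<and> bihomomorphism A H (assoc_beta A H q)"

end

theory Submission
  imports Defs
begin

text \<open>By the definition of beta, \<open>q (a + b) = q a * q b * beta a b\<close>, with the
  source written additively and the target multiplicatively. Passing from \<open>k a\<close> to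
  \<open>(k + 1) a\<close> thus multiplies the value by \<open>q a * beta (k a) a\<close>, and
  \<open>beta (k a) a = (beta a a)^k\<close> since beta is a homomorphism in its first argument. The
  exponents of \<open>beta a a\<close> add up to \<open>0 + 1 + ... + (k - 1)\<close>, which is
  \<open>k choose 2\<close>. \<open>weak_quadratic_form_pow\<close> carries out this induction for
  an element of any group and values in any commutative group; the theorem is the case of the class
  of 1 in the cyclic group.\<close>

lemma assoc_beta_mult:
  assumes "comm_group H" "q \<in> carrier A \<rightarrow> carrier H"
    and "a \<in> carrier A" "b \<in> carrier A" "a \<otimes>\<^bsub>A\<^esub> b \<in> carrier A"
  shows "q (a \<otimes>\<^bsub>A\<^esub> b) = q a \<otimes>\<^bsub>H\<^esub> q b \<otimes>\<^bsub>H\<^esub> assoc_beta A H q a b"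
proof -
  interpret H: comm_group H by fact
  have "q a \<in> carrier H" "q b \<in> carrier H" "q (a \<otimes>\<^bsub>A\<^esub> b) \<in> carrier H"
    using assms by auto
  then show ?thesis
    unfolding assoc_beta_def
    by (metis H.inv_closed H.inv_solve_right' H.m_assoc H.m_closed H.m_comm)
qed

text \<open>Base case of the later induction. A homomorphism preserves the identity, so beta is
  trivial at the pair of identities; the product rule there reads \<open>q 1 = q 1 * q 1\<close>,
  and one factor cancels.\<close>

lemma weak_quadratic_form_one:
  assumes "group A" "comm_group H" "weak_quadratic_form A H q"
  shows "q \<one>\<^bsub>A\<^esub> = \<one>\<^bsub>H\<^esub>"
proof -
  interpret A: group A by fact
  interpret H: comm_group H by fact
  have q: "q \<in> carrier A \<rightarrow> carrier H"
    and "(\<lambda>a. assoc_beta A H q a \<one>\<^bsub>A\<^esub>) \<in> hom A H"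
    using assms(3) by (auto simp: weak_quadratic_form_def bihomomorphism_def)
  then have "assoc_beta A H q \<one>\<^bsub>A\<^esub> \<one>\<^bsub>A\<^esub> = \<one>\<^bsub>H\<^esub>"
    using hom_one[OF _ A.is_group H.is_group] by fast
  moreover have "q \<one>\<^bsub>A\<^esub> \<in> carrier H"
    using q by auto
  ultimately show ?thesis
    using assoc_beta_mult[OF assms(2) q, of "\<one>\<^bsub>A\<^esub>" "\<one>\<^bsub>A\<^esub>"] by simp
qed

lemma weak_quadratic_form_pow:
  fixes k :: nat
  assumes "group A" "comm_group H" "weak_quadratic_form A H q" "a \<in> carrier A"
  shows "q (a [^]\<^bsub>A\<^esub> k) =
    q a [^]\<^bsub>H\<^esub> k \<otimes>\<^bsub>H\<^esub> assoc_beta A H q a a [^]\<^bsub>H\<^esub> (k choose 2)"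
proof -
  interpret A: group A by fact
  interpret H: comm_group H by fact
  have q: "q \<in> carrier A \<rightarrow> carrier H"
    and "(\<lambda>x. assoc_beta A H q x a) \<in> hom A H"
    using assms(3,4) by (auto simp: weak_quadratic_form_def bihomomorphism_def)
  \<comment> \<open>The second argument stays fixed at \<open>a\<close>, so powers of
    \<open>a\<close> in the first argument become powers of
    \<open>assoc_beta A H q a a\<close>.\<close>
  then interpret beta: group_hom A H "\<lambda>x. assoc_beta A H q x a"
    by unfold_locales
  have qa: "q a \<in> carrier H" and ba: "assoc_beta A H q a a \<in> carrier H"
    using q assms(4) by auto
  show ?thesis
  proof (induction k)
    case 0
    show ?case
      using weak_quadratic_form_one[OF assms(1-3)] by (simp add: numeral_2_eq_2)
  next
    case (Suc k)
    let ?b = "assoc_beta A H q a a"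
    have "q (a [^]\<^bsub>A\<^esub> Suc k) =
        q (a [^]\<^bsub>A\<^esub> k) \<otimes>\<^bsub>H\<^esub> q a \<otimes>\<^bsub>H\<^esub> assoc_beta A H q (a [^]\<^bsub>A\<^esub> k) a"
      using assoc_beta_mult[OF assms(2) q, of "a [^]\<^bsub>A\<^esub> k" a] assms(4) by simp
    also have "assoc_beta A H q (a [^]\<^bsub>A\<^esub> k) a = ?b [^]\<^bsub>H\<^esub> k"
      using beta.hom_nat_pow[OF assms(4)] by simp
    also have "q (a [^]\<^bsub>A\<^esub> k) \<otimes>\<^bsub>H\<^esub> q a \<otimes>\<^bsub>H\<^esub> ?b [^]\<^bsub>H\<^esub> k =
        q a [^]\<^bsub>H\<^esub> Suc k \<otimes>\<^bsub>H\<^esub> (?b [^]\<^bsub>H\<^esub> k \<otimes>\<^bsub>H\<^esub> ?b [^]\<^bsub>H\<^esub> (k choose 2))"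
      using qa ba by (simp add: Suc.IH H.m_ac)
    \<comment> \<open>Pascal's rule, \<open>(k choose 1) + (k choose 2) = (Suc k choose 2)\<close>;
      writing 2 as \<open>Suc (Suc 0)\<close> exposes the recursion of the binomial
      coefficient.\<close>
    also have "?b [^]\<^bsub>H\<^esub> k \<otimes>\<^bsub>H\<^esub> ?b [^]\<^bsub>H\<^esub> (k choose 2) = ?b [^]\<^bsub>H\<^esub> (Suc k choose 2)"
      using ba by (simp add: H.nat_pow_mult numeral_2_eq_2)
    finally show ?case .
  qed
qed

theorem lemma4p2p7:
  fixes K :: "('k, 'm) ring_scheme" and n k :: nat and q :: "int \<Rightarrow> 'k"
  assumes "field K"
    and "n \<ge> 1"
    and "weak_quadratic_form (integer_mod_group n) (units_of K) q"
    and "k \<ge> 2"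
  shows "q (int k mod int n) =
    q (1 mod int n) [^]\<^bsub>units_of K\<^esub> k \<otimes>\<^bsub>units_of K\<^esub>
    assoc_beta (integer_mod_group n) (units_of K) q (1 mod int n) (1 mod int n)
      [^]\<^bsub>units_of K\<^esub> (k choose 2)"
proof -
  interpret K: field K by fact
  \<comment> \<open>The carrier consists of the residues \<open>0, ..., n - 1\<close>, so for
    \<open>n = 1\<close> the class of 1 is represented by 0; hence \<open>1 mod int n\<close>
    instead of 1.\<close>
  have "1 mod int n \<in> carrier (integer_mod_group n)"
    using assms(2) by (simp add: carrier_integer_mod_group)
  from weak_quadratic_form_pow[OF group_integer_mod_group K.units_comm_group assms(3) this, of k]
  show ?thesis
    \<comment> \<open>The \<open>k\<close>-th power in the source is \<open>k * (1 mod n)\<close>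
      reduced modulo \<open>n\<close>, that is \<open>k mod n\<close>.\<close>
    by (simp add: mod_mult_right_eq)
qed

end
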